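(* Let $X$ be a sequentially complete locally convex space, $T$ a linear operator on $X$, and $\lambda\in\mathbb{C}$. If $|\lambda|>r_l(T)$, then the Neumann series $\sum_{i=0}^\infty \frac{T^i}{\lambda^{i+1}}$ converges pointwise to a linear operator $R_\lambda^0$ on $X$, and $R_\lambda^0(\lambda I-T)=I$. Moreover, if $T$ is continuous, then (whenever $|\lambda|>r_l(T)$) $\lambda I-T$ is invertible as a linear operator with $R_\lambda^0=R_\lambda=(\lambda I-T)^{-1}$, and $|\sigma^l(T)|\le r_l(T)$.
   Context: Spaces are over $\mathbb{C}$; locally convex spaces are Hausdorff by definition; $I$ is the identity operator. For a linear operator $T$ on $X$: $\rho^l(T)$ is the set of $\lambda\in\mathbb{C}$ for which $\lambda I-T$ is invertible in the algebra of all linear operators on $X$, $\sigma^l(T)=\mathbb{C}\setminus\rho^l(T)$, and $R_\lambda$ denotes the two-sided inverse of $\lambda I-T$ when it exists. For $\sigma\subseteq\mathbb{C}$, $|\sigma|=\sup\{|\lambda| : \lambda\in\sigma\}$, with $\sup\emptyset=0$. The spectral radius $r_l(T)$ is $$r_l(T)=\inf\Bigl\{\nu>0 : \tfrac{T^nx}{\nu^n}\to 0 \text{ as } n\to\infty \text{ for every } x\in X\Bigr\},$$ with $\inf\emptyset=\infty$. *)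

theory Defs
  imports Complex_Main "HOL-Library.Extended_Nonnegative_Real"
begin

text \<open>Continuity of addition and negation, and the Hausdorff property, come from the type
  classes; the complex scalar multiplication is an explicit parameter.\<close>

locale locally_convex_space = vector_space scale
  for scale :: "complex \<Rightarrow> 'a::{topological_ab_group_add, t2_space} \<Rightarrow> 'a" +
  assumes continuous_scale: "continuous_on UNIV (\<lambda>(c, x). scale c x)"
    and convex_nhds_zero: "\<And>U. open U \<Longrightarrow> 0 \<in> U \<Longrightarrow>
      \<exists>V. open V \<and> 0 \<in> V \<and> V \<subseteq> U \<and>
        (\<forall>x\<in>V. \<forall>y\<in>V. \<forall>t::real. 0 \<le> t \<and> t \<le> 1 \<longrightarrow>
          scale (of_real (1 - t)) x + scale (of_real t) y \<in> V)"

text \<open>Cauchy sequences are taken with respect to the translation-invariant uniformity; the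
  library's \<open>Cauchy\<close> would need a uniformity as additional structure.\<close>

definition Cauchy_seq :: "(nat \<Rightarrow> 'a::topological_ab_group_add) \<Rightarrow> bool" where
  "Cauchy_seq S \<longleftrightarrow>
    (\<forall>U. open U \<and> 0 \<in> U \<longrightarrow> (\<exists>N. \<forall>m\<ge>N. \<forall>n\<ge>N. S m - S n \<in> U))"

definition sequentially_complete :: "'a::topological_ab_group_add itself \<Rightarrow> bool" where
  "sequentially_complete _ \<longleftrightarrow> (\<forall>S :: nat \<Rightarrow> 'a. Cauchy_seq S \<longrightarrow> convergent S)"

abbreviation linear_operator ::
  "(complex \<Rightarrow> 'a \<Rightarrow> 'a) \<Rightarrow> ('a \<Rightarrow> 'a::ab_group_add) \<Rightarrow> bool" where
  "linear_operator scale \<equiv> Vector_Spaces.linear scale scale"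

definition shift ::
  "(complex \<Rightarrow> 'a \<Rightarrow> 'a) \<Rightarrow> ('a \<Rightarrow> 'a::ab_group_add) \<Rightarrow> complex \<Rightarrow> 'a \<Rightarrow> 'a" where
  "shift scale T \<mu> = (\<lambda>x. scale \<mu> x - T x)"

definition is_inverse_operator ::
  "(complex \<Rightarrow> 'a \<Rightarrow> 'a) \<Rightarrow> ('a \<Rightarrow> 'a) \<Rightarrow> ('a \<Rightarrow> 'a::ab_group_add) \<Rightarrow> bool" where
  "is_inverse_operator scale A R \<longleftrightarrow> linear_operator scale R \<and> R \<circ> A = id \<and> A \<circ> R = id"

definition resolvent_set ::
  "(complex \<Rightarrow> 'a \<Rightarrow> 'a) \<Rightarrow> ('a \<Rightarrow> 'a::ab_group_add) \<Rightarrow> complex set" where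
  "resolvent_set scale T = {\<mu>. \<exists>R. is_inverse_operator scale (shift scale T \<mu>) R}"

text \<open>Meaningful only for \<open>\<mu>\<close> in the resolvent set.\<close>

definition resolvent ::
  "(complex \<Rightarrow> 'a \<Rightarrow> 'a) \<Rightarrow> ('a \<Rightarrow> 'a::ab_group_add) \<Rightarrow> complex \<Rightarrow> 'a \<Rightarrow> 'a" where
  "resolvent scale T \<mu> = (THE R. is_inverse_operator scale (shift scale T \<mu>) R)"

definition spectrum ::
  "(complex \<Rightarrow> 'a \<Rightarrow> 'a) \<Rightarrow> ('a \<Rightarrow> 'a::ab_group_add) \<Rightarrow> complex set" where
  "spectrum scale T = - resolvent_set scale T"

text \<open>In \<open>ennreal\<close> the conventions \<open>sup \<emptyset> = 0\<close> and \<open>inf \<emptyset> = \<infinity>\<close> hold.\<close>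

definition set_modulus :: "complex set \<Rightarrow> ennreal" where
  "set_modulus \<sigma> = (SUP \<mu>\<in>\<sigma>. ennreal (cmod \<mu>))"

definition spectral_radius ::
  "(complex \<Rightarrow> 'a \<Rightarrow> 'a) \<Rightarrow> ('a \<Rightarrow> 'a::topological_ab_group_add) \<Rightarrow> ennreal" where
  "spectral_radius scale T =
    Inf {ennreal \<nu> |\<nu>. \<nu> > 0 \<and>
      (\<forall>x. (\<lambda>n. scale (of_real (1 / \<nu> ^ n)) ((T ^^ n) x)) \<longlonglongrightarrow> 0)}"

end

theory Submission
  imports Defs
begin

text \<open>Pick \<open>\<nu>\<close> strictly between the spectral radius and \<open>|\<mu>|\<close>, and put \<open>q = \<nu> / |\<mu>|\<close>. Since
  \<open>T\<^sup>i x / \<nu>\<^sup>i\<close> tends to zero, the \<open>i\<close>-th term of the Neumann series is \<open>(1 - q) q\<^sup>i z\<^sub>i\<close> with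
  \<open>z\<^sub>i \<longlonglongrightarrow> 0\<close>. Blocks of the series are thus sub-convex combinations of vectors from a convex
  neighbourhood of zero, so the partial sums are Cauchy. The rest is telescoping.\<close>

context locally_convex_space
begin

section \<open>Limits of scaled vectors and a Cauchy criterion\<close>

lemma tendsto_scale:
  assumes "(f \<longlongrightarrow> c) F" "(g \<longlongrightarrow> x) F"
  shows "((\<lambda>n. scale (f n) (g n)) \<longlongrightarrow> scale c x) F"
proof -
  have "isCont (\<lambda>(c, x). scale c x) (c, x)"
    using continuous_scale by (simp add: continuous_on_eq_continuous_at)
  from isCont_tendsto_compose[OF this tendsto_Pair[OF assms]] show ?thesis
    by simp
qed

text \<open>Joint continuity at \<open>(0, 0)\<close> only controls scalars in a small disc. Bounded
  scalars are brought into that disc by moving a fixed factor over to the null sequence.\<close>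

lemma tendsto_scale_bounded:
  fixes y :: "nat \<Rightarrow> 'a"
  assumes y: "y \<longlonglongrightarrow> 0" and B: "\<And>n. cmod (c n) \<le> B"
  shows "(\<lambda>n. scale (c n) (y n)) \<longlonglongrightarrow> 0"
proof (rule topological_tendstoI)
  fix U :: "'a set"
  assume U: "open U" "0 \<in> U"
  have "((\<lambda>p. scale (fst p) (snd p)) \<longlongrightarrow> scale 0 0) (nhds (0, 0))"
    by (rule tendsto_scale)
      (use tendsto_fst[OF filterlim_ident] tendsto_snd[OF filterlim_ident] in auto)
  then have "\<forall>\<^sub>F p in nhds (0, 0). scale (fst p) (snd p) \<in> U"
    using U by (auto simp: topological_tendstoD)
  then obtain P Q where P: "\<forall>\<^sub>F a in nhds 0. P a" and Q: "\<forall>\<^sub>F w in nhds 0. Q w"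
    and PQ: "\<And>a w. P a \<Longrightarrow> Q w \<Longrightarrow> scale a w \<in> U"
    unfolding nhds_prod eventually_prod_filter by auto
  obtain d where d: "d > 0" "\<And>a. cmod a < d \<Longrightarrow> P a"
    using P unfolding eventually_nhds_metric by (auto simp: dist_norm)
  \<comment> \<open>Chosen so that \<open>c n / K\<close> has modulus below \<open>d\<close>. The
    compensating factor is harmless because \<open>K\<close> times \<open>y n\<close> still tends to
    zero.\<close>
  define K where "K = (\<bar>B\<bar> + 1) / d"
  have K: "K > 0" using d by (simp add: K_def)
  have "(\<lambda>n. scale (of_real K) (y n)) \<longlonglongrightarrow> 0"
    using tendsto_scale[OF tendsto_const y] by simp
  then have "\<forall>\<^sub>F n in sequentially. Q (scale (of_real K) (y n))"
    using Q by (rule eventually_compose_filterlim[rotated])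
  then show "\<forall>\<^sub>F n in sequentially. scale (c n) (y n) \<in> U"
  proof eventually_elim
    case (elim n)
    have "cmod (c n / of_real K) < d"
    proof -
      have "cmod (c n) < \<bar>B\<bar> + 1" using B[of n] by linarith
      also have "\<dots> = d * K" using d by (simp add: K_def)
      finally show ?thesis using K by (simp add: norm_divide field_simps)
    qed
    from PQ[OF d(2)[OF this] elim] show ?case using K by simp
  qed
qed

text \<open>The weights \<open>(1 - q) * q ^ i\<close> are nonnegative and every finite sum of them
  is at most 1, so a convex set containing zero absorbs each block whose vectors lie in it.\<close>

lemma Cauchy_seq_geometric:
  fixes z :: "nat \<Rightarrow> 'a" and q :: real
  assumes z: "z \<longlonglongrightarrow> 0" and q: "0 \<le> q" "q \<le> 1"
  shows "Cauchy_seq (\<lambda>n. \<Sum>i<n. scale (of_real ((1 - q) * q ^ i)) (z i))"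
  unfolding Cauchy_seq_def
proof (intro allI impI)
  fix U :: "'a set"
  assume U: "open U \<and> 0 \<in> U"
  let ?S = "\<lambda>n. \<Sum>i<n. scale (of_real ((1 - q) * q ^ i)) (z i)"
  \<comment> \<open>Symmetrizing \<open>U\<close> lets the estimate for \<open>n \<le> m\<close>
    serve the opposite order as well.\<close>
  have "open (U \<inter> uminus -` U)"
    using U by (intro open_Int open_vimage continuous_intros) auto
  then obtain V where V: "open V" "0 \<in> V" "V \<subseteq> U \<inter> uminus -` U"
    and conv: "\<And>x y t::real. x \<in> V \<Longrightarrow> y \<in> V \<Longrightarrow> 0 \<le> t \<Longrightarrow> t \<le> 1 \<Longrightarrow>
      scale (of_real (1 - t)) x + scale (of_real t) y \<in> V"
    using convex_nhds_zero[of "U \<inter> uminus -` U"] U by auto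
  \<comment> \<open>Horner's scheme: splitting off \<open>w 0\<close> leaves \<open>q\<close> times
    the same sum for the shifted sequence, a convex combination with parameter \<open>q\<close>.
    Hence the induction is over all \<open>w\<close>.\<close>
  have block: "(\<Sum>i<k. scale (of_real ((1 - q) * q ^ i)) (w i)) \<in> V"
    if "\<And>i. w i \<in> V" for w k
    using that
  proof (induction k arbitrary: w)
    case (Suc k)
    have "(\<Sum>i<Suc k. scale (of_real ((1 - q) * q ^ i)) (w i)) = scale (of_real (1 - q)) (w 0)
      + scale (of_real q) (\<Sum>i<k. scale (of_real ((1 - q) * q ^ i)) (w (Suc i)))"
      by (simp only: sum.lessThan_Suc_shift) (simp add: scale_sum_right mult_ac)
    also have "\<dots> \<in> V"
      by (rule conv[OF Suc.prems Suc.IH q]) (rule Suc.prems)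
    finally show ?case .
  qed (use V in simp)
  obtain N where N: "\<And>n. n \<ge> N \<Longrightarrow> z n \<in> V"
    using topological_tendstoD[OF z V(1,2)] by (auto simp: eventually_sequentially)
  have diff: "?S m - ?S n \<in> V" if "N \<le> n" "n \<le> m" for m n
  proof -
    have "?S (n + k) = ?S n + (\<Sum>i<k. scale (of_real ((1 - q) * q ^ (n + i))) (z (n + i)))" for k
      by (induction k) (simp_all add: add.assoc)
    from this[of "m - n"]
    have "?S m = ?S n + (\<Sum>i<m - n. scale (of_real ((1 - q) * q ^ (n + i))) (z (n + i)))"
      using that by simp
    also have "(\<Sum>i<m - n. scale (of_real ((1 - q) * q ^ (n + i))) (z (n + i)))
      = scale (of_real (q ^ n)) (\<Sum>i<m - n. scale (of_real ((1 - q) * q ^ i)) (z (n + i)))"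
      by (simp add: scale_sum_right power_add mult_ac)
    finally have "?S m - ?S n
      = scale (of_real (q ^ n)) (\<Sum>i<m - n. scale (of_real ((1 - q) * q ^ i)) (z (n + i)))"
      by simp
    moreover have "(\<Sum>i<m - n. scale (of_real ((1 - q) * q ^ i)) (z (n + i))) \<in> V"
      using that by (intro block N) simp
    \<comment> \<open>The remaining factor \<open>q ^ n\<close> is a convex combination with
      \<open>0 \<in> V\<close>.\<close>
    ultimately show ?thesis
      using conv[OF V(2), of _ "q ^ n"] q by (simp add: power_le_one)
  qed
  show "\<exists>N. \<forall>m\<ge>N. \<forall>n\<ge>N. ?S m - ?S n \<in> U"
  proof (intro exI allI impI)
    fix m n
    assume mn: "N \<le> m" "N \<le> n"
    show "?S m - ?S n \<in> U"
    proof (cases "n \<le> m")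
      case True
      then show ?thesis using diff[OF mn(2)] V(3) by blast
    next
      case False
      then have "?S n - ?S m \<in> uminus -` U" using diff[OF mn(1), of n] V(3) by auto
      then show ?thesis by simp
    qed
  qed
qed

section \<open>Convergence and linearity of the Neumann series\<close>

lemma linear_funpow:
  assumes "linear_operator scale T"
  shows "linear_operator scale (T ^^ n)"
proof (induction n)
  case 0
  then show ?case by (simp add: id_def[symmetric] linear_id)
next
  case (Suc n)
  then show ?case using assms by (simp add: Vector_Spaces.linear_iff)
qed

text \<open>Passing from \<open>\<nu>\<close> to \<open>\<mu>\<close> multiplies by powers of
  \<open>\<nu> / \<mu>\<close>, which have modulus at most 1. This disposes of the remainder in the
  telescoped series.\<close>

lemma scaled_funpow_tendsto_0:
  assumes \<nu>: "0 < \<nu>" "\<nu> \<le> cmod \<mu>"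
    and orbit: "(\<lambda>n. scale (of_real (1 / \<nu> ^ n)) ((T ^^ n) x)) \<longlonglongrightarrow> 0"
  shows "(\<lambda>n. scale (1 / \<mu> ^ n) ((T ^^ n) x)) \<longlonglongrightarrow> 0"
proof -
  have "cmod ((of_real \<nu> / \<mu>) ^ n) \<le> 1" for n
    unfolding norm_power using \<nu> by (intro power_le_one) (auto simp: norm_divide divide_le_eq_1)
  then have "(\<lambda>n. scale ((of_real \<nu> / \<mu>) ^ n)
      (scale (of_real (1 / \<nu> ^ n)) ((T ^^ n) x))) \<longlonglongrightarrow> 0"
    by (rule tendsto_scale_bounded[OF orbit])
  then show ?thesis
    using \<nu> by (simp add: power_divide)
qed

lemma neumann_summable:
  assumes complete: "sequentially_complete TYPE('a)"
    and \<nu>: "0 < \<nu>" "\<nu> < cmod \<mu>"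
    and orbit: "(\<lambda>n. scale (of_real (1 / \<nu> ^ n)) ((T ^^ n) x)) \<longlonglongrightarrow> 0"
  shows "summable (\<lambda>i. scale (1 / \<mu> ^ (i + 1)) ((T ^^ i) x))"
proof -
  define q where "q = \<nu> / cmod \<mu>"
  have \<mu>: "\<mu> \<noteq> 0" using \<nu> by auto
  have q: "0 < q" "q < 1" using \<nu> by (auto simp: q_def divide_simps)
  \<comment> \<open>The correction that turns the geometric weight times the scaled orbit into the
    Neumann term. As \<open>q ^ i\<close> cancels the growth of the quotient, its modulus does not
    depend on \<open>i\<close>.\<close>
  define c where "c i = of_real (\<nu> ^ i) / (\<mu> ^ (i + 1) * of_real ((1 - q) * q ^ i))" for i
  have "cmod (c i) \<le> 1 / (cmod \<mu> * (1 - q))" for i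
  proof -
    have "cmod (c i) = \<nu> ^ i / (cmod \<mu> ^ (i + 1) * ((1 - q) * q ^ i))"
      unfolding c_def norm_divide norm_mult norm_power norm_of_real using q \<nu> by simp
    also have "\<dots> = 1 / (cmod \<mu> * (1 - q))"
      using \<nu> \<mu> q(2) by (simp add: q_def power_divide)
    finally show ?thesis by simp
  qed
  from tendsto_scale_bounded[OF orbit this]
  have "Cauchy_seq (\<lambda>n. \<Sum>i<n. scale (of_real ((1 - q) * q ^ i))
      (scale (c i) (scale (of_real (1 / \<nu> ^ i)) ((T ^^ i) x))))"
    by (rule Cauchy_seq_geometric) (use q in auto)
  moreover have "of_real ((1 - q) * q ^ i) * (c i * of_real (1 / \<nu> ^ i)) = 1 / \<mu> ^ (i + 1)" for i
  proof -
    have "complex_of_real ((1 - q) * q ^ i) \<noteq> 0" "complex_of_real (\<nu> ^ i) \<noteq> 0"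
      using q \<nu> by auto
    then show ?thesis
      using \<mu> unfolding c_def of_real_divide
      by (simp add: divide_simps del: of_real_mult of_real_power of_real_diff)
  qed
  ultimately have "Cauchy_seq (\<lambda>n. \<Sum>i<n. scale (1 / \<mu> ^ (i + 1)) ((T ^^ i) x))"
    by (simp only: scale_scale)
  then have "convergent (\<lambda>n. \<Sum>i<n. scale (1 / \<mu> ^ (i + 1)) ((T ^^ i) x))"
    using complete by (auto simp: sequentially_complete_def)
  then show ?thesis by (simp add: summable_iff_convergent)
qed

lemma linear_scale_compose:
  assumes "linear_operator scale f"
  shows "linear_operator scale (\<lambda>x. scale c (f x))"
  using assms unfolding Vector_Spaces.linear_iff
  by (auto simp only: scale_right_distrib intro: scale_left_commute)

text \<open>Both sides of each linearity identity are sums of the same series, and limits in a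
  Hausdorff space are unique.\<close>

lemma linear_suminf:
  assumes "\<And>i. linear_operator scale (f i)" "\<And>x. (\<lambda>i. f i x) sums R x"
  shows "linear_operator scale R"
proof -
  have "f i (x + y) = f i x + f i y" "f i (scale c x) = scale c (f i x)" for i c x y
    using assms(1)[of i] by (simp_all add: Vector_Spaces.linear_iff)
  then have "(\<lambda>i. f i (x + y)) sums (R x + R y)" "(\<lambda>i. f i (scale c x)) sums scale c (R x)" for c x y
    using sums_add[OF assms(2)[of x] assms(2)[of y]]
      tendsto_scale[OF tendsto_const assms(2)[of x, unfolded sums_def], of c]
    by (simp_all add: sums_def scale_sum_right)
  then have "R (x + y) = R x + R y" "R (scale c x) = scale c (R x)" for c x y
    using sums_unique2[OF assms(2)] by blast+
  then show ?thesis by (simp add: Vector_Spaces.linear_iff vector_space_axioms)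
qed

section \<open>The Neumann series as an inverse\<close>

lemma neumann_partial_sum_telescope:
  assumes "linear_operator scale T" "\<mu> \<noteq> 0"
  shows "(\<Sum>i<n. scale (1 / \<mu> ^ (i + 1)) ((T ^^ i) (shift scale T \<mu> x)))
    = x - scale (1 / \<mu> ^ n) ((T ^^ n) x)"
proof (induction n)
  case (Suc n)
  interpret T: Vector_Spaces.linear scale scale "T ^^ n" using assms(1) by (rule linear_funpow)
  \<comment> \<open>The new summand is \<open>T^n x / \<mu>^n - T^(n+1) x / \<mu>^(n+1)\<close>; its
    first half cancels the old remainder.\<close>
  show ?case using Suc assms(2)
    by (simp add: shift_def T.diff T.scale scale_right_diff_distrib funpow_swap1)
qed simp

text \<open>\<open>shift scale T \<mu>\<close> commutes with powers of \<open>T\<close>, so the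
  right inverse property reduces to the same telescoping sum as the left one.\<close>

lemma shift_neumann_partial_sum:
  assumes "linear_operator scale T"
  shows "shift scale T \<mu> (\<Sum>i<n. scale (1 / \<mu> ^ (i + 1)) ((T ^^ i) x))
    = (\<Sum>i<n. scale (1 / \<mu> ^ (i + 1)) ((T ^^ i) (shift scale T \<mu> x)))"
proof -
  interpret T: Vector_Spaces.linear scale scale T by (rule assms)
  have "(T ^^ i) (shift scale T \<mu> x) = scale \<mu> ((T ^^ i) x) - T ((T ^^ i) x)" for i
  proof -
    interpret Ti: Vector_Spaces.linear scale scale "T ^^ i" using assms by (rule linear_funpow)
    show ?thesis by (simp add: shift_def Ti.diff Ti.scale funpow_swap1)
  qed
  then show ?thesis
    by (simp add: shift_def T.sum T.scale scale_sum_right scale_right_diff_distrib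
        sum_subtractf mult.commute)
qed

text \<open>A left inverse and a right inverse of the same map coincide, so the definite description
  has exactly one candidate.\<close>

lemma resolvent_eq:
  assumes "is_inverse_operator scale (shift scale T \<mu>) R"
  shows "resolvent scale T \<mu> = R"
  unfolding resolvent_def
proof (rule the_equality)
  fix R' assume R': "is_inverse_operator scale (shift scale T \<mu>) R'"
  have "R' = R' \<circ> (shift scale T \<mu> \<circ> R)" using assms by (simp add: is_inverse_operator_def)
  also have "\<dots> = R" using R' by (simp add: is_inverse_operator_def flip: comp_assoc)
  finally show "R' = R" .
qed (rule assms)

lemma neumann_series:
  assumes complete: "sequentially_complete TYPE('a)"
    and T: "linear_operator scale T"
    and \<mu>: "spectral_radius scale T < ennreal (cmod \<mu>)"
  obtains R0 where "linear_operator scale R0"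
    "\<And>x. (\<lambda>i. scale (1 / \<mu> ^ (i + 1)) ((T ^^ i) x)) sums R0 x"
    "R0 \<circ> shift scale T \<mu> = id"
    "continuous_on UNIV T \<Longrightarrow> is_inverse_operator scale (shift scale T \<mu>) R0"
proof -
  \<comment> \<open>An infimum strictly below \<open>cmod \<mu>\<close> yields a member of the set
    below it; this one \<open>\<nu>\<close> serves all \<open>x\<close>.\<close>
  obtain \<nu> where \<nu>: "0 < \<nu>" "\<nu> < cmod \<mu>"
    and orbit: "\<And>x. (\<lambda>n. scale (of_real (1 / \<nu> ^ n)) ((T ^^ n) x)) \<longlonglongrightarrow> 0"
    using \<mu> unfolding spectral_radius_def Inf_less_iff by (auto simp: ennreal_less_iff)
  have [simp]: "\<mu> \<noteq> 0" using \<nu> by auto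
  define R0 where "R0 x = (\<Sum>i. scale (1 / \<mu> ^ (i + 1)) ((T ^^ i) x))" for x
  have sums: "(\<lambda>i. scale (1 / \<mu> ^ (i + 1)) ((T ^^ i) x)) sums R0 x" for x
    unfolding R0_def using neumann_summable[OF complete \<nu> orbit] by (rule summable_sums)
  have lin: "linear_operator scale R0"
    by (rule linear_suminf[OF linear_scale_compose[OF linear_funpow[OF T]] sums])
  have "(\<lambda>n. x - scale (1 / \<mu> ^ n) ((T ^^ n) x)) \<longlonglongrightarrow> x - 0" for x
    by (intro tendsto_diff tendsto_const scaled_funpow_tendsto_0[OF \<nu>(1) _ orbit])
      (use \<nu> in simp)
  then have tele: "(\<lambda>n. \<Sum>i<n. scale (1 / \<mu> ^ (i + 1)) ((T ^^ i) (shift scale T \<mu> x)))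
      \<longlonglongrightarrow> x" for x
    by (simp only: neumann_partial_sum_telescope[OF T \<open>\<mu> \<noteq> 0\<close>] diff_zero)
  have left: "R0 \<circ> shift scale T \<mu> = id"
    using LIMSEQ_unique[OF sums[unfolded sums_def] tele] by auto
  have right: "shift scale T \<mu> \<circ> R0 = id" if cont: "continuous_on UNIV T"
  proof
    fix x
    let ?S = "\<lambda>n. \<Sum>i<n. scale (1 / \<mu> ^ (i + 1)) ((T ^^ i) x)"
    have S: "?S \<longlonglongrightarrow> R0 x" using sums by (simp only: sums_def)
    have "isCont T (R0 x)" using cont by (simp add: continuous_on_eq_continuous_at)
    \<comment> \<open>Continuity of \<open>T\<close> carries the shift through the limit of the
      partial sums.\<close>
    then have "(\<lambda>n. shift scale T \<mu> (?S n)) \<longlonglongrightarrow> shift scale T \<mu> (R0 x)"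
      unfolding shift_def
      by (intro tendsto_diff tendsto_scale tendsto_const S isCont_tendsto_compose[OF _ S])
    then have "(\<lambda>n. \<Sum>i<n. scale (1 / \<mu> ^ (i + 1)) ((T ^^ i) (shift scale T \<mu> x)))
        \<longlonglongrightarrow> shift scale T \<mu> (R0 x)"
      by (simp only: shift_neumann_partial_sum[OF T])
    then show "(shift scale T \<mu> \<circ> R0) x = id x"
      using LIMSEQ_unique tele by auto
  qed
  show thesis
    by (rule that[OF lin sums left]) (simp_all add: is_inverse_operator_def lin left right)
qed

end

theorem theorem5p1:
  fixes scale :: "complex \<Rightarrow> 'a::{topological_ab_group_add, t2_space} \<Rightarrow> 'a"
    and T :: "'a \<Rightarrow> 'a"
  assumes "locally_convex_space scale"
    and "sequentially_complete TYPE('a)"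
    and "linear_operator scale T"
  shows "(\<forall>\<mu>. ennreal (cmod \<mu>) > spectral_radius scale T \<longrightarrow>
      (\<exists>R0. linear_operator scale R0
        \<and> (\<forall>x. (\<lambda>i. scale (1 / \<mu> ^ (i + 1)) ((T ^^ i) x)) sums R0 x)
        \<and> R0 \<circ> shift scale T \<mu> = id
        \<and> (continuous_on UNIV T \<longrightarrow>
            \<mu> \<in> resolvent_set scale T \<and> R0 = resolvent scale T \<mu>)))
    \<and> (continuous_on UNIV T \<longrightarrow>
        set_modulus (spectrum scale T) \<le> spectral_radius scale T)"
proof (intro conjI allI impI)
  interpret locally_convex_space scale by (rule assms(1))
  show "\<exists>R0. linear_operator scale R0
        \<and> (\<forall>x. (\<lambda>i. scale (1 / \<mu> ^ (i + 1)) ((T ^^ i) x)) sums R0 x)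
        \<and> R0 \<circ> shift scale T \<mu> = id
        \<and> (continuous_on UNIV T \<longrightarrow>
            \<mu> \<in> resolvent_set scale T \<and> R0 = resolvent scale T \<mu>)"
    if \<mu>: "ennreal (cmod \<mu>) > spectral_radius scale T" for \<mu>
  proof -
    obtain R0 where R0: "linear_operator scale R0"
      "\<And>x. (\<lambda>i. scale (1 / \<mu> ^ (i + 1)) ((T ^^ i) x)) sums R0 x"
      "R0 \<circ> shift scale T \<mu> = id"
      and inv: "continuous_on UNIV T \<Longrightarrow> is_inverse_operator scale (shift scale T \<mu>) R0"
      by (rule neumann_series[OF assms(2,3) \<mu>]) (rule that; blast)
    have "\<mu> \<in> resolvent_set scale T \<and> R0 = resolvent scale T \<mu>" if "continuous_on UNIV T"
      using inv[OF that] resolvent_eq[OF inv[OF that]] by (auto simp: resolvent_set_def)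
    then show ?thesis using R0 by blast
  qed
  show "set_modulus (spectrum scale T) \<le> spectral_radius scale T" if "continuous_on UNIV T"
    unfolding set_modulus_def
  \<comment> \<open>A spectral point beyond the radius would have the Neumann sum as its
    inverse.\<close>
  proof (rule SUP_least, rule ccontr)
    fix \<mu>
    assume "\<mu> \<in> spectrum scale T" "\<not> ennreal (cmod \<mu>) \<le> spectral_radius scale T"
    then have "\<mu> \<notin> resolvent_set scale T" "spectral_radius scale T < ennreal (cmod \<mu>)"
      by (auto simp: spectrum_def)
    from this(2) show False
    proof (rule neumann_series[OF assms(2,3)])
      fix R0
      assume "continuous_on UNIV T \<Longrightarrow> is_inverse_operator scale (shift scale T \<mu>) R0"
      with \<open>continuous_on UNIV T\<close> \<open>\<mu> \<notin> resolvent_set scale T\<close> show False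
        by (auto simp: resolvent_set_def)
    qed
  qed
qed

end
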